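(* Let $n,d\geq 1$ be integers, let $\sigma\in\mathcal{S}^{(1)}(\mathbb{R}^{2nd})$ and let $f_j,g_j\in\mathcal{S}^{(1)}(\mathbb{R}^d)$, $j=1,\dots,n$. Put $\vec f=f_1\otimes\dots\otimes f_n$ and $\vec g=g_1\otimes\dots\otimes g_n$. Then the multilinear Weyl pseudodifferential operator $L_\sigma$, given by $$L_\sigma(\vec f)(x)=\int_{\mathbb{R}^{2nd}}\sigma\Big(\frac{x+y}{2},\omega\Big)\,\vec f(y)\,e^{2\pi i (x-y)\cdot\omega}\,dy\,d\omega,\qquad x\in\mathbb{R}^{nd},$$ extends to a continuous map from $\mathcal{S}^{(1)}(\mathbb{R}^{nd})$ to $\mathcal{S}^{(1)'}(\mathbb{R}^{nd})$, and the following formula holds: $$\langle L_\sigma\vec f,\vec g\rangle=\langle\sigma,W(\vec g,\vec f)\rangle .$$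
   Context: For $m\geq1$, the Gelfand--Shilov space $\mathcal{S}^{(1)}(\mathbb{R}^m)$ consists of all functions $f$ on $\mathbb{R}^m$ such that $\|f(x)e^{h|x|}\|_{L^\infty}<\infty$ and $\|\hat f(\omega)e^{h|\omega|}\|_{L^\infty}<\infty$ for every $h>0$, with the topology given by these norms; here $\hat f(\omega)=\int f(t)e^{-2\pi i t\cdot\omega}\,dt$. Its dual is denoted $\mathcal{S}^{(1)'}(\mathbb{R}^m)$. The bracket $\langle\cdot,\cdot\rangle$ denotes the extension of the $L^2$ inner product $\langle f,g\rangle=\int f(t)\overline{g(t)}\,dt$ (linear in the first and conjugate-linear in the second argument) to pairs of dual spaces. Points of $\mathbb{R}^{nd}$ are written $x=(x_1,\dots,x_n)$ with $x_j\in\mathbb{R}^d$, and $x\cdot\omega=\sum_{j=1}^n x_j\cdot\omega_j$. The vector $\vec f=(f_1,\dots,f_n)$ is identified with the tensor product, $\vec f(y)=\prod_{j=1}^n f_j(y_j)$. The multilinear Wigner transform is $$W(\vec f,\vec g)(x,\omega)=\int_{\mathbb{R}^{nd}}\prod_{j=1}^n\Big(f_j\big(x_j+\tfrac{t_j}{2}\big)\overline{g_j\big(x_j-\tfrac{t_j}{2}\big)}\Big)e^{-2\pi i\,\omega\cdot t}\,dt,\qquad x,\omega\in\mathbb{R}^{nd}.$$ *)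

theory Defs
  imports "HOL-Probability.Probability"
begin

section \<open>Topologies generated by families of seminorms\<close>

text \<open>Vector spaces are sets \<open>V\<close> of complex-valued functions; seminorms take values in
  \<^typ>\<open>ereal\<close> and are finite on \<open>V\<close> in all uses below.\<close>

definition clinear_on :: "('b \<Rightarrow> complex) set \<Rightarrow> (('b \<Rightarrow> complex) \<Rightarrow> complex) \<Rightarrow> bool" where
  "clinear_on V u \<longleftrightarrow>
     (\<forall>F\<in>V. \<forall>G\<in>V. \<forall>a b. u (\<lambda>x. a * F x + b * G x) = a * u F + b * u G)"

definition seminorm_topology ::
    "('b \<Rightarrow> complex) set \<Rightarrow> (('b \<Rightarrow> complex) \<Rightarrow> ereal) set \<Rightarrow> ('b \<Rightarrow> complex) topology" where
  "seminorm_topology V P =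
     topology_generated_by
       {{G \<in> V. p (\<lambda>x. G x - F x) < ereal r} | p F r. p \<in> P \<and> F \<in> V \<and> 0 < r}"

definition seminorm_bounded ::
    "('b \<Rightarrow> complex) set \<Rightarrow> (('b \<Rightarrow> complex) \<Rightarrow> ereal) set \<Rightarrow> ('b \<Rightarrow> complex) set \<Rightarrow> bool" where
  "seminorm_bounded V P B \<longleftrightarrow> B \<subseteq> V \<and> (\<forall>p\<in>P. (SUP F\<in>B. p F) < \<infinity>)"

section \<open>The Gelfand--Shilov space and its dual\<close>

definition fourier :: "('a::euclidean_space \<Rightarrow> complex) \<Rightarrow> 'a \<Rightarrow> complex" where
  "fourier f \<omega> = (LINT t|lborel. f t * exp (- 2 * of_real pi * \<i> * of_real (t \<bullet> \<omega>)))"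

definition weighted_Linf :: "real \<Rightarrow> ('a::euclidean_space \<Rightarrow> complex) \<Rightarrow> ereal" where
  "weighted_Linf h f = esssup lborel (\<lambda>x. ereal (norm (f x) * exp (h * norm x)))"

definition GS_seminorms :: "(('a::euclidean_space \<Rightarrow> complex) \<Rightarrow> ereal) set" where
  "GS_seminorms = {weighted_Linf h | h. 0 < h} \<union> {\<lambda>f. weighted_Linf h (fourier f) | h. 0 < h}"

text \<open>The elements are measurable functions, not classes modulo null sets. Two functions that agree
  almost everywhere have seminorm distance zero and are therefore topologically indistinguishable;
  every element agrees almost everywhere with a smooth one.\<close>

definition GS :: "('a::euclidean_space \<Rightarrow> complex) set" where
  "GS = {f \<in> borel_measurable lborel. \<forall>p\<in>GS_seminorms. p f < \<infinity>}"

definition GS_topology :: "('a::euclidean_space \<Rightarrow> complex) topology" where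
  "GS_topology = seminorm_topology GS GS_seminorms"

text \<open>The dual consists of the continuous linear functionals, made extensional
  outside \<^const>\<open>GS\<close>, and carries the strong topology (uniform convergence on bounded sets),
  which is finer than the weak-* topology.\<close>

definition GS_dual :: "(('a::euclidean_space \<Rightarrow> complex) \<Rightarrow> complex) set" where
  "GS_dual = {u \<in> extensional GS. clinear_on GS u \<and> continuous_map GS_topology euclidean u}"

definition GS_dual_seminorms :: "((('a::euclidean_space \<Rightarrow> complex) \<Rightarrow> complex) \<Rightarrow> ereal) set" where
  "GS_dual_seminorms =
     {\<lambda>u. (SUP \<phi>\<in>B. ereal (norm (u \<phi>))) | B. seminorm_bounded GS GS_seminorms B}"

definition GS_dual_topology :: "(('a::euclidean_space \<Rightarrow> complex) \<Rightarrow> complex) topology" where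
  "GS_dual_topology = seminorm_topology GS_dual GS_dual_seminorms"

definition L2_inner :: "('a::euclidean_space \<Rightarrow> complex) \<Rightarrow> ('a \<Rightarrow> complex) \<Rightarrow> complex" where
  "L2_inner f g = (LINT t|lborel. f t * cnj (g t))"

text \<open>Functionals in the dual are linear, so the conjugation that makes the bracket
  conjugate-linear in its second argument is applied to the test function. A function \<open>F\<close> is
  identified with the functional \<open>\<phi> \<mapsto> \<integral> F \<phi>\<close>, hence \<^term>\<open>bracket\<close> extends \<^const>\<open>L2_inner\<close>.\<close>

definition bracket ::
    "(('a::euclidean_space \<Rightarrow> complex) \<Rightarrow> complex) \<Rightarrow> ('a \<Rightarrow> complex) \<Rightarrow> complex" where
  "bracket u g = u (\<lambda>x. cnj (g x))"

definition represented_by ::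
    "(('a::euclidean_space \<Rightarrow> complex) \<Rightarrow> complex) \<Rightarrow> ('a \<Rightarrow> complex) \<Rightarrow> bool" where
  "represented_by u F \<longleftrightarrow>
     (\<forall>\<phi>\<in>GS. integrable lborel (\<lambda>x. F x * \<phi> x) \<and> u \<phi> = (LINT x|lborel. F x * \<phi> x))"

section \<open>Multilinear Wigner transform and Weyl operators\<close>

text \<open>A point of \<open>\<real>\<^sup>n\<^sup>d\<close> is an element \<open>x\<close> of \<^typ>\<open>real^'d^'n\<close>, with blocks \<open>x $ j\<close> in
  \<^typ>\<open>real^'d\<close>; its inner product is the sum of the inner products of the blocks. \<open>\<real>\<^sup>2\<^sup>n\<^sup>d\<close> is the
  product of two copies of this type, with the Euclidean norm.\<close>

definition tensor :: "('n::finite \<Rightarrow> real^'d \<Rightarrow> complex) \<Rightarrow> real^'d^'n \<Rightarrow> complex" where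
  "tensor f y = (\<Prod>j\<in>UNIV. f j (y $ j))"

definition wigner ::
    "('n::finite \<Rightarrow> real^'d \<Rightarrow> complex) \<Rightarrow> ('n \<Rightarrow> real^'d \<Rightarrow> complex)
      \<Rightarrow> (real^'d^'n) \<times> (real^'d^'n) \<Rightarrow> complex" where
  "wigner f g = (\<lambda>(x, \<omega>). LINT t|lborel.
     (\<Prod>j\<in>UNIV. f j (x $ j + (1/2) *\<^sub>R t $ j) * cnj (g j (x $ j - (1/2) *\<^sub>R t $ j)))
       * exp (- 2 * of_real pi * \<i> * of_real (\<omega> \<bullet> t)))"

definition weyl_op ::
    "((real^'d^'n) \<times> (real^'d^'n) \<Rightarrow> complex) \<Rightarrow> (real^'d^'n \<Rightarrow> complex)
      \<Rightarrow> real^'d^'n \<Rightarrow> complex" where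
  "weyl_op \<sigma> F x = (LINT (y, \<omega>)|lborel.
     \<sigma> ((1/2) *\<^sub>R (x + y), \<omega>) * F y * exp (2 * of_real pi * \<i> * of_real ((x - y) \<bullet> \<omega>)))"

end

theory Submission
  imports Defs
begin

text \<open>
  For \<open>F\<close> and \<open>\<phi>\<close> in the Gelfand--Shilov space, the extension of the Weyl operator is the functional
  \<open>T F \<phi> = \<integral> L\<^sub>\<sigma>F(x) \<phi>(x) dx\<close>. The integral defining \<open>L\<^sub>\<sigma>F(x)\<close> converges absolutely for every \<open>x\<close>, and the
  continuity of \<open>T\<close> follows from one estimate. If \<open>|\<sigma>(z, \<omega>)| \<le> c exp(-|(z, \<omega>)|)\<close> and
  \<open>|F(y)| \<le> a exp(-|y|)\<close> almost everywhere, then the integrand of \<open>L\<^sub>\<sigma>F(x)\<close> is at most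
  \<open>c a exp(-|(y, \<omega>)|)\<close>, uniformly in \<open>x\<close>. Hence \<open>|L\<^sub>\<sigma>F(x)| \<le> C a\<close> for all \<open>x\<close>, and if
  \<open>|\<phi>(x)| \<le> b exp(-|x|)\<close> then \<open>|T F \<phi>| \<le> M a b\<close> (\<open>weyl_pairing\<close>).

  A bilinear form with such a bound gives continuous functionals \<open>T F\<close>, and \<open>F \<mapsto> T F\<close> is continuous
  for the strong topology because \<open>b\<close> can be chosen uniformly on a bounded set of test functions
  (\<open>continuous_map_GS_into_dual\<close>). That \<open>T F\<close> is represented by \<open>L\<^sub>\<sigma>F\<close> is then the definition of
  \<open>T\<close>.

  A tensor product of Gelfand--Shilov functions is again one, since \<open>|y| \<le> \<Sum>\<^sub>j |y\<^sub>j|\<close> and the Fourier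
  transform of a tensor product is the tensor product of the Fourier transforms. The latter
  is Fubini's theorem on \<open>\<real>\<^sup>n\<^sup>d\<close>, whose Lebesgue measure is the \<open>n\<close>-fold product of the one on \<open>\<real>\<^sup>d\<close>
  (\<open>lborel_vec_eq_distr_PiM\<close>).

  The formula relating \<open>L\<^sub>\<sigma>\<close> to the Wigner transform is the substitution \<open>x = z + t/2\<close>, \<open>y = z - t/2\<close>
  in the absolutely convergent integral over \<open>(x, y, \<omega>)\<close>; it preserves Lebesgue measure
  (\<open>distr_wigner_coords\<close>), turns \<open>\<sigma>((x + y)/2, \<omega>)\<close> into \<open>\<sigma>(z, \<omega>)\<close> and \<open>x - y\<close> into \<open>t\<close>, and the integral
  over \<open>t\<close> that remains is the conjugate of \<open>W(g, f)(z, \<omega>)\<close> (\<open>weyl_wigner_duality\<close>).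
\<close>

section \<open>Exponential decay and the Gelfand--Shilov space\<close>

lemma integrable_exp_minus_norm_scaled_real:
  assumes u: "0 < (u::real)"
  shows "integrable lborel (\<lambda>x::real. exp (- (\<bar>x\<bar> * u)))"
proof -
  let ?h = "\<lambda>x::real. indicator {0<..} x *\<^sub>R exp (- (x * u))"
  have i1: "integrable lborel ?h"
    using integrable_I0i_exp_mscale[OF u] by (simp add: set_integrable_def)
  have i2: "integrable lborel (\<lambda>x. ?h (0 + (-1) * x))"
    using lborel_integrable_real_affine_iff[of "-1" ?h 0] i1 by simp
  have i3: "integrable lborel (\<lambda>x. ?h x + ?h (0 + (-1) * x))"
    using i1 i2 by (rule Bochner_Integration.integrable_add)
  show ?thesis
  proof (rule integrable_cong_AE_imp[OF i3])
    show "AE x in lborel. ?h x + ?h (0 + (-1) * x) = exp (- (\<bar>x\<bar> * u))"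
      using AE_lborel_singleton[of 0] by eventually_elim (auto simp: indicator_def)
  qed simp
qed

text \<open>Since \<open>|x|\<close> dominates the mean of the \<open>|x\<^sub>b|\<close> over the coordinates \<open>b\<close>, the function is dominated
  by a product of one-dimensional exponentials, to which Tonelli's theorem applies.\<close>

lemma integrable_exp_minus_norm:
  "integrable lborel (\<lambda>x::'a::euclidean_space. exp (- norm x))"
proof -
  define u where "u = 1 / real DIM('a)"
  have u: "0 < u" by (simp add: u_def)
  let ?P = "\<lambda>x::'a. \<Prod>b\<in>Basis. exp (- (\<bar>x \<bullet> b\<bar> * u))"
  have "(\<integral>\<^sup>+x. ennreal (?P x) \<partial>lborel) = (\<integral>\<^sup>+x. (\<Prod>b\<in>Basis. ennreal (exp (- (\<bar>x \<bullet> b\<bar> * u)))) \<partial>(lborel::'a measure))"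
    by (simp add: prod_ennreal)
  also have "\<dots> = (\<Prod>b\<in>(Basis::'a set). \<integral>\<^sup>+x. ennreal (exp (- (\<bar>x\<bar> * u))) \<partial>lborel)"
    by (rule nn_integral_lborel_prod) auto
  also have "\<dots> < \<infinity>"
    using integrable_exp_minus_norm_scaled_real[OF u]
    by (simp add: integrable_iff_bounded less_top[symmetric] ennreal_prod_eq_top power_eq_top_ennreal)
  finally have P: "integrable lborel ?P"
    by (intro integrableI_bounded) (auto simp: abs_of_nonneg prod_nonneg)
  have le: "norm (exp (- norm x)) \<le> norm (?P x)" for x :: 'a
  proof -
    have "(\<Sum>b\<in>Basis. \<bar>x \<bullet> b\<bar> * u) \<le> (\<Sum>b\<in>(Basis::'a set). norm x * u)"
      by (intro sum_mono mult_right_mono Basis_le_norm) (use u in auto)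
    also have "\<dots> = norm x" by (simp add: u_def)
    finally have "exp (- norm x) \<le> exp (- (\<Sum>b\<in>Basis. \<bar>x \<bullet> b\<bar> * u))" by simp
    also have "\<dots> = ?P x" by (simp add: exp_sum sum_negf[symmetric])
    finally show ?thesis by simp
  qed
  show ?thesis
    by (rule Bochner_Integration.integrable_bound[OF P]) (use le in auto)
qed

text \<open>A bound \<open>c\<close> on \<^const>\<open>weighted_Linf\<close> in the form in which it is used: a real constant and a pointwise
  estimate almost everywhere, so that the extended reals stay out of the analysis.\<close>

definition decays :: "real \<Rightarrow> real \<Rightarrow> ('a::euclidean_space \<Rightarrow> complex) \<Rightarrow> bool" where
  "decays h c f \<longleftrightarrow> (AE x in lborel. norm (f x) \<le> c * exp (- (h * norm x)))"

lemma decays_mono: "decays h c f \<Longrightarrow> c \<le> c' \<Longrightarrow> decays h c' f"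
  unfolding decays_def by (erule eventually_mono) (meson exp_ge_zero mult_right_mono order_trans)

text \<open>Lebesgue measure is nonzero, so the estimate holds at some point.\<close>

lemma decays_nonneg:
  fixes f :: "'a::euclidean_space \<Rightarrow> complex"
  assumes "decays h c f"
  shows "0 \<le> c"
proof -
  have "AE x in (lborel::'a measure). 0 \<le> c"
    using assms unfolding decays_def
    by (rule eventually_mono) (metis exp_gt_zero norm_ge_zero order_trans zero_le_mult_iff not_le)
  then show ?thesis by (simp add: eventually_const_iff ae_filter_eq_bot_iff)
qed

lemma integrable_if_decays:
  assumes [measurable]: "f \<in> borel_measurable borel" and "decays 1 c f"
  shows "integrable lborel f"
proof (rule Bochner_Integration.integrable_bound)
  show "integrable lborel (\<lambda>x. c * exp (- norm x))"
    by (intro integrable_mult_right integrable_exp_minus_norm)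
  show "AE x in lborel. norm (f x) \<le> norm (c * exp (- norm x))"
    using assms(2) decays_nonneg[OF assms(2)] by (auto simp: decays_def abs_mult)
qed simp

lemma fourier_measurable[measurable]:
  fixes f :: "'a::euclidean_space \<Rightarrow> complex"
  assumes [measurable]: "f \<in> borel_measurable borel"
  shows "fourier f \<in> borel_measurable borel"
  unfolding fourier_def by measurable

lemma weighted_Linf_le:
  assumes [measurable]: "f \<in> borel_measurable borel" and "decays h c f"
  shows "weighted_Linf h f \<le> ereal c"
  unfolding weighted_Linf_def
proof (rule esssup_I)
  show "AE x in lborel. ereal (norm (f x) * exp (h * norm x)) \<le> ereal c"
    using assms(2) unfolding decays_def
    by eventually_elim (simp add: exp_minus field_simps)
qed simp

lemma decays_if_weighted_Linf_le:
  assumes "weighted_Linf h f \<le> ereal c"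
  shows "decays h c f"
proof -
  have "AE x in lborel. ereal (norm (f x) * exp (h * norm x)) \<le> ereal c"
    using esssup_AE[of "\<lambda>x. ereal (norm (f x) * exp (h * norm x))" lborel] assms
    unfolding weighted_Linf_def by (elim eventually_mono) (erule order_trans)
  then show ?thesis
    unfolding decays_def by eventually_elim (simp add: exp_minus field_simps)
qed

lemma weighted_Linf_less_infinity_iff:
  assumes "f \<in> borel_measurable borel"
  shows "weighted_Linf h f < \<infinity> \<longleftrightarrow> (\<exists>c. decays h c f)"
proof
  assume "weighted_Linf h f < \<infinity>"
  then obtain c where "weighted_Linf h f \<le> ereal c"
    by (cases "weighted_Linf h f") auto
  then show "\<exists>c. decays h c f" by (blast intro: decays_if_weighted_Linf_le)
next
  assume "\<exists>c. decays h c f"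
  then obtain c where "decays h c f" by blast
  from weighted_Linf_le[OF assms this] show "weighted_Linf h f < \<infinity>" by auto
qed

text \<open>The Fourier transform of a measurable function is measurable, so both families of seminorms
  can be read as pointwise decay.\<close>

lemma GS_iff:
  "f \<in> GS \<longleftrightarrow> f \<in> borel_measurable borel \<and>
     (\<forall>h>0. (\<exists>c. decays h c f) \<and> (\<exists>c. decays h c (fourier f)))"
proof -
  have "(\<forall>p\<in>GS_seminorms. p f < \<infinity>) \<longleftrightarrow>
      (\<forall>h>0. weighted_Linf h f < \<infinity> \<and> weighted_Linf h (fourier f) < \<infinity>)"
    by (auto simp: GS_seminorms_def)
  then show ?thesis
    by (auto simp: GS_def weighted_Linf_less_infinity_iff fourier_measurable simp del: ereal_infty_less)
qed

lemma GS_measurable: "f \<in> GS \<Longrightarrow> f \<in> borel_measurable borel"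
  by (simp add: GS_iff)

lemma GS_integrable: "f \<in> GS \<Longrightarrow> integrable lborel f"
  by (metis GS_iff integrable_if_decays zero_less_one)

lemma norm_exp_2pi_i:
  "norm (exp (2 * of_real pi * \<i> * of_real r :: complex)) = 1"
  "norm (exp (- (2 * of_real pi * \<i> * of_real r) :: complex)) = 1"
  by (simp_all add: norm_exp_eq_Re)

lemma decays_lincomb:
  assumes "decays h c f" "decays h d g"
  shows "decays h (norm a * c + norm b * d) (\<lambda>x. a * f x + b * g x)"
  using assms unfolding decays_def
proof eventually_elim
  case (elim x)
  have "norm (a * f x + b * g x) \<le> norm a * norm (f x) + norm b * norm (g x)"
    by (metis norm_mult norm_triangle_ineq)
  also have "\<dots> \<le> norm a * (c * exp (- (h * norm x))) + norm b * (d * exp (- (h * norm x)))"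
    using elim by (intro add_mono mult_left_mono) auto
  finally show ?case by (simp add: algebra_simps)
qed

lemma fourier_integrand_integrable:
  fixes f :: "'a::euclidean_space \<Rightarrow> complex"
  assumes "integrable lborel f"
  shows "integrable lborel (\<lambda>t. f t * exp (- 2 * of_real pi * \<i> * of_real (t \<bullet> \<omega>)))"
  by (rule Bochner_Integration.integrable_bound[OF assms])
    (use assms in \<open>auto simp: norm_mult norm_exp_2pi_i\<close>)

lemma fourier_lincomb:
  assumes "integrable lborel f" "integrable lborel g"
  shows "fourier (\<lambda>x. a * f x + b * g x) \<omega> = a * fourier f \<omega> + b * fourier g \<omega>"
  unfolding fourier_def
  using fourier_integrand_integrable[OF assms(1), of \<omega>] fourier_integrand_integrable[OF assms(2), of \<omega>]
  by (simp add: distrib_right mult.assoc)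

lemma GS_lincomb:
  assumes "f \<in> GS" "g \<in> GS"
  shows "(\<lambda>x. a * f x + b * g x) \<in> GS"
proof -
  have eq: "fourier (\<lambda>x. a * f x + b * g x) = (\<lambda>\<omega>. a * fourier f \<omega> + b * fourier g \<omega>)"
    by (intro ext fourier_lincomb GS_integrable assms)
  have [measurable]: "f \<in> borel_measurable borel" "g \<in> borel_measurable borel"
    using assms by (auto simp: GS_iff)
  show ?thesis
    unfolding GS_iff eq
    using assms by (auto simp: GS_iff) (blast intro: decays_lincomb)+
qed

lemma GS_diff: "f \<in> GS \<Longrightarrow> g \<in> GS \<Longrightarrow> (\<lambda>x. f x - g x) \<in> GS"
  using GS_lincomb[of f g 1 "-1"] by simp

lemma AE_lborel_uminus:
  assumes "AE x in (lborel :: 'a::euclidean_space measure). P x"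
  shows "AE x in (lborel :: 'a measure). P (- x)"
proof -
  have "distr lborel borel uminus = (lborel :: 'a measure)"
    using lborel_affine[of "-1" "0::'a"] by (simp add: density_1)
  then have "AE x in distr (lborel :: 'a measure) borel uminus. P x"
    using assms by (simp only:)
  then show ?thesis by (rule AE_distrD[rotated]) simp
qed

lemma fourier_cnj: "fourier (\<lambda>x. cnj (f x)) \<omega> = cnj (fourier f (- \<omega>))"
  unfolding fourier_def
  by (subst Bochner_Integration.integral_cnj[symmetric], rule Bochner_Integration.integral_cong) (simp_all add: exp_cnj)

text \<open>Needed because the bracket conjugates its test function. The Fourier transform of a conjugate is
  the conjugate of the reflected Fourier transform, and reflection preserves null sets.\<close>

lemma GS_cnj:
  assumes "f \<in> GS"
  shows "(\<lambda>x. cnj (f x)) \<in> GS"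
proof -
  have eq: "fourier (\<lambda>x. cnj (f x)) = (\<lambda>\<omega>. cnj (fourier f (- \<omega>)))"
    by (rule ext) (rule fourier_cnj)
  have [measurable]: "f \<in> borel_measurable borel"
    using assms by (auto simp: GS_iff)
  have "(\<lambda>x. cnj (f x)) \<in> borel_measurable borel"
    by (rule measurable_compose[of f borel borel cnj])
      (auto intro!: borel_measurable_continuous_onI continuous_intros)
  have 1: "decays h c (\<lambda>\<omega>. cnj (fourier f (- \<omega>)))" if "decays h c (fourier f)" for h c
    using AE_lborel_uminus[OF that[unfolded decays_def]] by (simp add: decays_def)
  have 2: "decays h c (\<lambda>\<omega>. cnj (f \<omega>))" if "decays h c f" for h c
    using that by (simp add: decays_def)
  show ?thesis
    unfolding GS_iff eq using assms 1 2 \<open>(\<lambda>x. cnj (f x)) \<in> borel_measurable borel\<close> unfolding GS_iff by metis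
qed

section \<open>Tensor products\<close>

lemma vec_nth_measurable[measurable]:
  "(\<lambda>x::'a::euclidean_space^'n. x $ j) \<in> borel_measurable borel"
  by (intro borel_measurable_continuous_onI continuous_intros)

lemma vec_lambda_measurable_PiM[measurable]:
  "(\<lambda>h. \<chi> j. h j :: 'a::euclidean_space^'n) \<in>
     (\<Pi>\<^sub>M j\<in>(UNIV::'n::finite set). (lborel :: 'a measure)) \<rightarrow>\<^sub>M borel"
  by (subst borel_measurable_euclidean_space) (auto simp: Basis_vec_def inner_axis)

text \<open>Both measures give a box the product of its side lengths, since the basis vectors of the space of
  block vectors are the basis vectors of the individual blocks. This makes Fubini's theorem for an
  arbitrary finite number of blocks available.\<close>

lemma lborel_vec_eq_distr_PiM:
  "(lborel :: ('a::euclidean_space^'n::finite) measure) =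
     distr (\<Pi>\<^sub>M j\<in>UNIV. lborel) borel (\<lambda>h. \<chi> j. h j)"
proof (rule lborel_eqI)
  interpret product_sigma_finite "\<lambda>_::'n. lborel :: 'a measure" ..
  fix l u :: "'a^'n"
  assume le: "\<And>b. b \<in> Basis \<Longrightarrow> l \<bullet> b \<le> u \<bullet> b"
  have le': "l $ j \<bullet> b \<le> u $ j \<bullet> b" if "b \<in> Basis" for j b
    using le[of "axis j b"] that by (auto simp: Basis_vec_def inner_axis)
  have "emeasure (distr (\<Pi>\<^sub>M j\<in>(UNIV::'n set). lborel :: 'a measure) borel (\<lambda>h. \<chi> j. h j)) (box l u) =
    emeasure (\<Pi>\<^sub>M j\<in>(UNIV::'n set). lborel :: 'a measure) (\<Pi>\<^sub>E j\<in>UNIV. box (l $ j) (u $ j))"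
    by (subst emeasure_distr)
      (auto intro!: arg_cong2[where f = emeasure] simp: mem_box Basis_vec_def inner_axis space_PiM PiE_iff)
  also have "\<dots> = (\<Prod>j\<in>UNIV. emeasure lborel (box (l $ j) (u $ j)))"
    by (rule emeasure_PiM) auto
  also have "\<dots> = ennreal (\<Prod>j\<in>UNIV. \<Prod>b\<in>Basis. (u $ j - l $ j) \<bullet> b)"
    using le' by (subst prod_ennreal[symmetric]) (auto simp: inner_diff_left intro!: prod_nonneg)
  also have "(\<Prod>j\<in>UNIV. \<Prod>b\<in>Basis. (u $ j - l $ j) \<bullet> b) = (\<Prod>b\<in>Basis. (u - l) \<bullet> b)"
  proof -
    have "inj_on (\<lambda>(j, b). axis j b) ((UNIV::'n set) \<times> (Basis :: 'a set))"
      by (auto simp: inj_on_def axis_eq_axis)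
    then have "(\<Prod>b\<in>(\<lambda>(j, b). axis j b) ` (UNIV \<times> Basis). (u - l) \<bullet> b) =
        (\<Prod>j\<in>UNIV. \<Prod>b\<in>Basis. (u $ j - l $ j) \<bullet> b)"
      by (simp add: prod.reindex prod.cartesian_product inner_axis case_prod_unfold)
    moreover have "(Basis :: ('a^'n) set) = (\<lambda>(j, b). axis j b) ` (UNIV \<times> Basis)"
      by (auto simp: Basis_vec_def)
    ultimately show ?thesis by (simp only:)
  qed
  finally show "emeasure (distr (\<Pi>\<^sub>M j\<in>(UNIV::'n set). lborel :: 'a measure) borel (\<lambda>h. \<chi> j. h j)) (box l u)
     = ennreal (\<Prod>b\<in>Basis. (u - l) \<bullet> b)" .
qed simp

text \<open>The cylinder over a null set is a product of sets one of which is null.\<close>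

lemma AE_lborel_vec_component:
  fixes j :: "'n::finite"
  assumes "AE x in (lborel :: 'a::euclidean_space measure). P x"
  shows "AE y in (lborel :: ('a^'n) measure). P (y $ j)"
proof -
  interpret product_sigma_finite "\<lambda>_::'n. lborel :: 'a measure" ..
  obtain N where N: "{x. \<not> P x} \<subseteq> N" "N \<in> sets lborel" "emeasure lborel N = 0"
    using assms by (auto elim!: AE_E)
  have m: "(\<lambda>y::'a^'n. y $ j) \<in> borel_measurable borel" by simp
  let ?M = "{y::'a^'n. y $ j \<in> N}"
  have sM: "?M \<in> sets borel"
    using measurable_sets[OF m, of N] N(2) by (simp add: vimage_def)
  have "emeasure lborel ?M =
      emeasure (\<Pi>\<^sub>M i\<in>(UNIV::'n set). lborel :: 'a measure) (\<Pi>\<^sub>E i\<in>UNIV. if i = j then N else UNIV)"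
    by (subst lborel_vec_eq_distr_PiM, subst emeasure_distr)
      (use sM in \<open>auto intro!: arg_cong2[where f = emeasure] simp: space_PiM PiE_iff split: if_splits\<close>)
  also have "\<dots> = (\<Prod>i\<in>UNIV. emeasure lborel (if i = j then N else UNIV))"
    by (rule emeasure_PiM) (use N in auto)
  also have "\<dots> = 0"
    using N(3) by (intro prod_zero) (auto intro!: bexI[of _ j])
  finally have "emeasure lborel ?M = 0" .
  then show ?thesis
    by (intro AE_I[of _ _ ?M]) (use N sM in auto)
qed

lemma integral_lborel_vec_prod:
  fixes f :: "'n::finite \<Rightarrow> 'a::euclidean_space \<Rightarrow> complex"
  assumes "\<And>j. integrable lborel (f j)"
  shows "(LINT y|lborel. (\<Prod>j\<in>UNIV. f j (y $ j))) = (\<Prod>j\<in>UNIV. (LINT x|lborel. f j x))"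
proof -
  interpret product_sigma_finite "\<lambda>_::'n. lborel :: 'a measure" ..
  have [measurable]: "f j \<in> borel_measurable borel" for j
    using borel_measurable_integrable[OF assms[of j]] by simp
  have "(LINT y|lborel. (\<Prod>j\<in>UNIV. f j (y $ j))) =
      (LINT h|(\<Pi>\<^sub>M j\<in>UNIV. lborel). (\<Prod>j\<in>UNIV. f j (h j)))"
    by (subst lborel_vec_eq_distr_PiM, subst integral_distr) auto
  also have "\<dots> = (\<Prod>j\<in>UNIV. (LINT x|lborel. f j x))"
    by (rule product_integral_prod) (auto simp: assms)
  finally show ?thesis .
qed

text \<open>The exponential factors over the blocks, as \<open>y \<bullet> \<omega> = \<Sum>\<^sub>j y\<^sub>j \<bullet> \<omega>\<^sub>j\<close>, so the integral is a product.\<close>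

lemma fourier_tensor:
  fixes f :: "'n::finite \<Rightarrow> real^'d \<Rightarrow> complex"
  assumes "\<And>j. integrable lborel (f j)"
  shows "fourier (tensor f) = tensor (\<lambda>j. fourier (f j))"
proof
  fix \<omega> :: "real^'d^'n"
  have "fourier (tensor f) \<omega> = (LINT y|lborel. (\<Prod>j\<in>UNIV.
      f j (y $ j) * exp (- 2 * of_real pi * \<i> * of_real (y $ j \<bullet> \<omega> $ j))))"
    unfolding fourier_def tensor_def
    by (simp add: prod.distrib inner_vec_def[of _ \<omega>] exp_sum[symmetric] sum_distrib_left sum_negf)
  also have "\<dots> = (\<Prod>j\<in>UNIV. fourier (f j) (\<omega> $ j))"
    unfolding fourier_def
    by (rule integral_lborel_vec_prod) (intro fourier_integrand_integrable assms)
  finally show "fourier (tensor f) \<omega> = tensor (\<lambda>j. fourier (f j)) \<omega>" by (simp add: tensor_def)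
qed

text \<open>The rate \<open>h\<close> is not lost, because \<open>|y| \<le> \<Sum>\<^sub>j |y\<^sub>j|\<close>.\<close>

lemma decays_tensor:
  fixes f :: "'n::finite \<Rightarrow> real^'d \<Rightarrow> complex"
  assumes h: "0 \<le> h" and "\<And>j. decays h (c j) (f j)"
  shows "decays h (\<Prod>j\<in>UNIV. c j) (tensor f)"
proof -
  have "AE y in lborel. \<forall>j. norm (f j (y $ j)) \<le> c j * exp (- (h * norm (y $ j)))"
    using assms(2) by (auto simp: decays_def AE_all_countable intro!: AE_lborel_vec_component)
  then show ?thesis
    unfolding decays_def
  proof eventually_elim
    case (elim y)
    have "norm (tensor f y) = (\<Prod>j\<in>UNIV. norm (f j (y $ j)))"
      by (simp add: tensor_def prod_norm)
    also have "\<dots> \<le> (\<Prod>j\<in>UNIV. c j * exp (- (h * norm (y $ j))))"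
      using elim by (intro prod_mono) auto
    also have "\<dots> = (\<Prod>j\<in>UNIV. c j) * exp (- (h * (\<Sum>j\<in>UNIV. norm (y $ j))))"
      by (simp add: prod.distrib exp_sum[symmetric] sum_distrib_left sum_negf)
    also have "\<dots> \<le> (\<Prod>j\<in>UNIV. c j) * exp (- (h * norm y))"
      using h decays_nonneg[OF assms(2)]
      by (auto intro!: mult_left_mono prod_nonneg simp: norm_vec_def L2_set_le_sum)
    finally show ?case .
  qed
qed

lemma tensor_in_GS:
  fixes f :: "'n::finite \<Rightarrow> real^'d \<Rightarrow> complex"
  assumes "\<And>j. f j \<in> GS"
  shows "tensor f \<in> GS"
proof -
  have [measurable]: "f j \<in> borel_measurable borel" for j using assms by (simp add: GS_iff)
  have "tensor f \<in> borel_measurable borel"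
    unfolding tensor_def[abs_def] by measurable
  moreover have "\<exists>c. decays h c (tensor F)" if "0 < h" "\<And>j. \<exists>c. decays h c (F j)"
    for h and F :: "'n \<Rightarrow> real^'d \<Rightarrow> complex"
    using that decays_tensor[of h _ F] by (metis less_imp_le)
  moreover have "fourier (tensor f) = tensor (\<lambda>j. fourier (f j))"
    by (intro fourier_tensor GS_integrable assms)
  ultimately show ?thesis
    using assms by (simp add: GS_iff)
qed

section \<open>Continuity from seminorm estimates\<close>

lemma topspace_seminorm_topology:
  assumes "P \<noteq> {}" "\<And>p. p \<in> P \<Longrightarrow> p (\<lambda>_. 0) \<le> 0"
  shows "topspace (seminorm_topology V P) = V"
proof -
  obtain p where p: "p \<in> P" using assms(1) by blast
  have "F \<in> \<Union> {{G \<in> V. p (\<lambda>x. G x - F x) < ereal r} | p F r. p \<in> P \<and> F \<in> V \<and> 0 < r}"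
    if "F \<in> V" for F
  proof (rule UnionI)
    have "p (\<lambda>_. 0) < ereal 1"
      using assms(2)[OF p] by (rule le_less_trans) simp
    then show "F \<in> {G \<in> V. p (\<lambda>x. G x - F x) < ereal 1}" using that by simp
  qed (use p that in \<open>force intro!: exI[of _ 1]\<close>)
  then show ?thesis
    unfolding seminorm_topology_def topology_generated_by_topspace by auto
qed

text \<open>A set that contains a ball around each of its points is a union of balls, which are subbasic; each
  point lies in its ball because a seminorm in \<open>P\<close> is at most 0 at the zero function.\<close>

lemma openin_seminorm_topologyI:
  assumes zero: "\<And>p. p \<in> P \<Longrightarrow> p (\<lambda>_. 0) \<le> 0"
    and "S \<subseteq> V"
    and ball: "\<And>F. F \<in> S \<Longrightarrow> \<exists>p\<in>P. \<exists>r>0. {G \<in> V. p (\<lambda>x. G x - F x) < ereal r} \<subseteq> S"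
  shows "openin (seminorm_topology V P) S"
proof (subst openin_subopen, intro ballI)
  fix F assume F: "F \<in> S"
  then obtain p r where pr: "p \<in> P" "0 < r" "{G \<in> V. p (\<lambda>x. G x - F x) < ereal r} \<subseteq> S"
    using ball by blast
  let ?B = "{G \<in> V. p (\<lambda>x. G x - F x) < ereal r}"
  have "F \<in> V" using F \<open>S \<subseteq> V\<close> by blast
  have "openin (seminorm_topology V P) ?B"
    unfolding seminorm_topology_def
    by (rule topology_generated_by_Basis) (use pr \<open>F \<in> V\<close> in blast)
  moreover have "F \<in> ?B"
    using zero[OF pr(1)] pr(2) \<open>F \<in> V\<close> by (auto intro: le_less_trans)
  ultimately show "\<exists>T. openin (seminorm_topology V P) T \<and> F \<in> T \<and> T \<subseteq> S"
    using pr(3) by blast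
qed

lemma GS_seminorms_zero:
  fixes p :: "('b::euclidean_space \<Rightarrow> complex) \<Rightarrow> ereal"
  assumes "p \<in> GS_seminorms"
  shows "p (\<lambda>_. 0) \<le> 0"
proof -
  have "weighted_Linf h (\<lambda>_::'b::euclidean_space. 0) \<le> ereal 0" for h
    by (rule weighted_Linf_le) (auto simp: decays_def)
  moreover have "fourier (\<lambda>_::'b::euclidean_space. 0) = (\<lambda>_. 0)"
    by (simp add: fourier_def fun_eq_iff)
  ultimately show ?thesis
    using assms by (auto simp: GS_seminorms_def zero_ereal_def)
qed

lemma weighted_Linf_in_GS_seminorms: "0 < h \<Longrightarrow> weighted_Linf h \<in> GS_seminorms"
  by (auto simp: GS_seminorms_def)

lemma topspace_GS_topology: "topspace GS_topology = GS"
  unfolding GS_topology_def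
  by (rule topspace_seminorm_topology)
    (use weighted_Linf_in_GS_seminorms[OF zero_less_one] GS_seminorms_zero in auto)

text \<open>The form in which openness follows from the estimates below, which are all stated for the decay
  rate 1.\<close>

lemma openin_GS_topologyI:
  assumes "S \<subseteq> GS"
    and "\<And>F. F \<in> S \<Longrightarrow> \<exists>r>0. \<forall>G\<in>GS. decays 1 r (\<lambda>x. G x - F x) \<longrightarrow> G \<in> S"
  shows "openin GS_topology S"
  unfolding GS_topology_def
proof (rule openin_seminorm_topologyI)
  fix F assume "F \<in> S"
  then obtain r where r: "r > 0" "\<And>G. G \<in> GS \<Longrightarrow> decays 1 r (\<lambda>x. G x - F x) \<Longrightarrow> G \<in> S"
    using assms(2) by blast
  then have "{G \<in> GS. weighted_Linf 1 (\<lambda>x. G x - F x) < ereal r} \<subseteq> S"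
    by (auto intro: decays_if_weighted_Linf_le less_imp_le)
  then show "\<exists>p\<in>GS_seminorms. \<exists>r>0. {G \<in> GS. p (\<lambda>x. G x - F x) < ereal r} \<subseteq> S"
    using r(1) weighted_Linf_in_GS_seminorms[OF zero_less_one] by blast
qed (use assms GS_seminorms_zero in auto)

lemma clinear_on_diff:
  assumes "clinear_on V u" "F \<in> V" "G \<in> V"
  shows "u (\<lambda>x. F x - G x) = u F - u G"
proof -
  have "u (\<lambda>x. 1 * F x + (- 1) * G x) = 1 * u F + (- 1) * u G"
    using assms unfolding clinear_on_def by blast
  then show ?thesis by simp
qed

lemma continuous_map_GS_functional:
  assumes lin: "clinear_on GS u"
    and bound: "\<And>\<phi> b. \<phi> \<in> GS \<Longrightarrow> decays 1 b \<phi> \<Longrightarrow> norm (u \<phi>) \<le> M * b"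
  shows "continuous_map GS_topology euclidean u"
  unfolding continuous_map topspace_GS_topology
proof (intro conjI allI impI)
  fix U :: "complex set" assume "openin euclidean U"
  then have U: "open U" by simp
  show "openin GS_topology {\<phi> \<in> GS. u \<phi> \<in> U}"
  proof (rule openin_GS_topologyI)
    fix F assume F: "F \<in> {\<phi> \<in> GS. u \<phi> \<in> U}"
    then obtain e where e: "e > 0" "ball (u F) e \<subseteq> U"
      using U open_contains_ball by blast
    define r where "r = e / (\<bar>M\<bar> + 1)"
    have r: "r > 0" "M * r < e"
    proof -
      show "r > 0" using e by (simp add: r_def)
      then have "M * r < (\<bar>M\<bar> + 1) * r" by (intro mult_strict_right_mono) auto
      then show "M * r < e" by (simp add: r_def)
    qed
    have "u G \<in> U" if "G \<in> GS" "decays 1 r (\<lambda>x. G x - F x)" for G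
    proof -
      have "norm (u G - u F) \<le> M * r"
        using bound[OF GS_diff that(2)] clinear_on_diff[OF lin] F that(1) by simp
      then show ?thesis using r e by (auto simp: dist_norm norm_minus_commute)
    qed
    then show "\<exists>r>0. \<forall>G\<in>GS. decays 1 r (\<lambda>x. G x - F x) \<longrightarrow> G \<in> {\<phi> \<in> GS. u \<phi> \<in> U}"
      using r(1) by blast
  qed auto
qed auto

lemma GS_bounded_uniform_decay:
  assumes "seminorm_bounded GS GS_seminorms B"
  obtains R where "0 \<le> R" "\<And>\<phi>. \<phi> \<in> B \<Longrightarrow> decays 1 R \<phi>"
proof -
  have "(SUP \<phi>\<in>B. weighted_Linf 1 \<phi>) < \<infinity>"
    using assms weighted_Linf_in_GS_seminorms[OF zero_less_one]
    unfolding seminorm_bounded_def by blast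
  then obtain R where R: "(SUP \<phi>\<in>B. weighted_Linf 1 \<phi>) \<le> ereal R"
    by (cases "SUP \<phi>\<in>B. weighted_Linf 1 \<phi>") auto
  have "decays 1 (max R 0) \<phi>" if "\<phi> \<in> B" for \<phi>
  proof (rule decays_mono)
    show "decays 1 R \<phi>"
      using SUP_upper[OF that, of "weighted_Linf 1"] R by (intro decays_if_weighted_Linf_le) (rule order_trans)
  qed simp
  then show thesis by (intro that[of "max R 0"]) auto
qed

lemma GS_dual_seminorms_nonempty: "GS_dual_seminorms \<noteq> {}"
proof -
  have "seminorm_bounded GS GS_seminorms ({} :: ('a::euclidean_space \<Rightarrow> complex) set)"
    unfolding seminorm_bounded_def by (simp add: bot_ereal_def)
  then show ?thesis unfolding GS_dual_seminorms_def by blast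
qed

lemma GS_dual_seminorms_zero:
  assumes "p \<in> GS_dual_seminorms"
  shows "p (\<lambda>_. 0) \<le> 0"
proof -
  obtain B where "p = (\<lambda>u. SUP \<phi>\<in>B. ereal (norm (u \<phi>)))"
    using assms unfolding GS_dual_seminorms_def by blast
  then show ?thesis by (simp add: SUP_le_iff)
qed

text \<open>The seminorms of the dual are suprema over bounded sets \<open>B\<close>. On \<open>B\<close> the constant \<open>b\<close> in the bound
  \<open>M a b\<close> can be replaced by one \<open>R\<close>, so moving \<open>F\<close> by at most \<open>q\<close> in the decay seminorm moves \<open>T F\<close> by
  at most \<open>M q R\<close> in the seminorm of \<open>B\<close>.\<close>

lemma continuous_map_GS_into_dual:
  fixes T :: "('a::euclidean_space \<Rightarrow> complex) \<Rightarrow> ('b::euclidean_space \<Rightarrow> complex) \<Rightarrow> complex"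
  assumes ext: "\<And>F. F \<in> GS \<Longrightarrow> T F \<in> extensional GS"
    and lin: "\<And>F. F \<in> GS \<Longrightarrow> clinear_on GS (T F)"
    and lin': "\<And>\<phi>. \<phi> \<in> GS \<Longrightarrow> clinear_on GS (\<lambda>F. T F \<phi>)"
    and bound: "\<And>F \<phi> a b. F \<in> GS \<Longrightarrow> \<phi> \<in> GS \<Longrightarrow> decays 1 a F \<Longrightarrow> decays 1 b \<phi> \<Longrightarrow>
      norm (T F \<phi>) \<le> M * a * b"
    and M: "0 \<le> M"
  shows "continuous_map GS_topology GS_dual_topology T"
proof -
  have dual: "T F \<in> GS_dual" if F: "F \<in> GS" for F
  proof -
    obtain a where "decays 1 a F" using F by (metis GS_iff zero_less_one)
    then have "continuous_map GS_topology euclidean (T F)"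
      using F bound by (intro continuous_map_GS_functional[OF lin, of F "M * a"]) auto
    then show ?thesis using F ext lin by (simp add: GS_dual_def)
  qed
  define \<B> where "\<B> = {{G \<in> GS_dual. p (\<lambda>x. G x - F x) < ereal r} | p F r.
    p \<in> (GS_dual_seminorms :: ((('b \<Rightarrow> complex) \<Rightarrow> complex) \<Rightarrow> ereal) set) \<and> F \<in> GS_dual \<and> 0 < r}"
  have top: "GS_dual_topology = topology_generated_by \<B>"
    by (simp add: GS_dual_topology_def seminorm_topology_def \<B>_def)
  have "topspace (GS_dual_topology :: (('b \<Rightarrow> complex) \<Rightarrow> complex) topology) = GS_dual"
    unfolding GS_dual_topology_def
    by (rule topspace_seminorm_topology) (auto simp: GS_dual_seminorms_nonempty GS_dual_seminorms_zero)
  then have union: "\<Union> \<B> = GS_dual"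
    unfolding top topology_generated_by_topspace .
  show ?thesis
    unfolding top
  proof (rule continuous_on_generated_topo)
    show "T ` topspace GS_topology \<subseteq> \<Union> \<B>"
      unfolding union topspace_GS_topology using dual by auto
  next
    fix U assume "U \<in> \<B>"
    then obtain B u r where r: "0 < r" and B: "seminorm_bounded GS GS_seminorms B"
      and U: "U = {G \<in> GS_dual. (SUP \<phi>\<in>B. ereal (norm (G \<phi> - u \<phi>))) < ereal r}"
      unfolding \<B>_def GS_dual_seminorms_def by blast
    obtain R where R: "0 \<le> R" "\<And>\<phi>. \<phi> \<in> B \<Longrightarrow> decays 1 R \<phi>"
      using GS_bounded_uniform_decay[OF B] by blast
    have BGS: "\<phi> \<in> GS" if "\<phi> \<in> B" for \<phi> using B that by (auto simp: seminorm_bounded_def)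
    show "openin GS_topology (T -` U \<inter> topspace GS_topology)"
    proof (rule openin_GS_topologyI)
      fix F assume F: "F \<in> T -` U \<inter> topspace GS_topology"
      then have FGS: "F \<in> GS" and less: "(SUP \<phi>\<in>B. ereal (norm (T F \<phi> - u \<phi>))) < ereal r"
        by (auto simp: U topspace_GS_topology)
      \<comment> \<open>There is room between the current distance and \<open>r\<close>; \<open>q\<close> is chosen so that a step of size \<open>q\<close> uses less than \<open>r - s\<close>.\<close>
      obtain s where s: "(SUP \<phi>\<in>B. ereal (norm (T F \<phi> - u \<phi>))) < ereal s" "s < r"
        using ereal_dense2[OF less] by auto
      \<comment> \<open>The summand 1 covers the case \<open>M * R = 0\<close>.\<close>
      define q where "q = (r - s) / (M * R + 1)"
      have MR: "0 \<le> M * R" using M R(1) by simp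
      have q: "q > 0" using s MR by (simp add: q_def)
      have qs: "M * q * R + s < r"
      proof -
        have "M * R * q < (M * R + 1) * q" using q by (intro mult_strict_right_mono) auto
        also have "\<dots> = r - s" using MR by (simp add: q_def)
        finally show ?thesis by (simp add: algebra_simps)
      qed
      have "G \<in> T -` U \<inter> topspace GS_topology"
        if G: "G \<in> GS" and dec: "decays 1 q (\<lambda>x. G x - F x)" for G
      proof -
        have "norm (T G \<phi> - u \<phi>) \<le> M * q * R + s" if \<phi>: "\<phi> \<in> B" for \<phi>
        proof -
          have "norm (T G \<phi> - T F \<phi>) \<le> M * q * R"
            using bound[OF GS_diff[OF G FGS] BGS[OF \<phi>] dec R(2)[OF \<phi>]]
              clinear_on_diff[OF lin'[OF BGS[OF \<phi>]] G FGS] by simp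
          moreover have "ereal (norm (T F \<phi> - u \<phi>)) < ereal s"
            by (rule le_less_trans[OF SUP_upper[OF \<phi>] s(1)])
          moreover have "norm (T G \<phi> - u \<phi>) \<le> norm (T G \<phi> - T F \<phi>) + norm (T F \<phi> - u \<phi>)"
            using norm_triangle_ineq[of "T G \<phi> - T F \<phi>" "T F \<phi> - u \<phi>"] by simp
          ultimately show ?thesis by simp
        qed
        then have "(SUP \<phi>\<in>B. ereal (norm (T G \<phi> - u \<phi>))) \<le> ereal (M * q * R + s)"
          by (intro SUP_least) simp
        also have "\<dots> < ereal r" using qs by simp
        finally show ?thesis using G dual by (simp add: U topspace_GS_topology)
      qed
      then show "\<exists>q>0. \<forall>G\<in>GS. decays 1 q (\<lambda>x. G x - F x) \<longrightarrow> G \<in> T -` U \<inter> topspace GS_topology"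
        by (intro exI[of _ q] conjI q ballI impI)
    qed (simp add: topspace_GS_topology)
  qed
qed

section \<open>The Weyl operator on exponentially decaying functions\<close>

text \<open>Membership of \<open>\<sigma>\<close> in the space only gives a bound outside a null set; to use it inside the Weyl
  integral for one fixed \<open>x\<close>, that null set is pulled back along an invertible affine map.\<close>

lemma AE_lborel_midpoint:
  fixes x :: "'a::euclidean_space"
  assumes "AE z in (lborel :: ('a \<times> 'b::euclidean_space) measure). P z"
  shows "AE p in (lborel :: ('a \<times> 'b) measure). P ((1/2) *\<^sub>R (x + fst p), snd p)"
proof -
  \<comment> \<open>The map scales the coordinates of the first factor by 1/2 and fixes those of the second.\<close>
  define c :: "'a \<times> 'b \<Rightarrow> real" where "c = (\<lambda>j. if fst j = 0 then 1 else 1/2)"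
  define \<tau> :: "'a \<times> 'b \<Rightarrow> 'a \<times> 'b"
    where "\<tau> p = ((1/2) *\<^sub>R x, 0) + (\<Sum>j\<in>Basis. (c j * (p \<bullet> j)) *\<^sub>R j)" for p
  have \<tau>: "\<tau> p = ((1/2) *\<^sub>R (x + fst p), snd p)" for p
  proof -
    have "(\<Sum>j\<in>Basis. (c j * (p \<bullet> j)) *\<^sub>R j) =
      (\<Sum>i\<in>Basis. (c (i, 0) * (fst p \<bullet> i)) *\<^sub>R (i, 0)) + (\<Sum>i\<in>Basis. (c (0, i) * (snd p \<bullet> i)) *\<^sub>R (0, i))"
      by (simp add: sum_Basis_prod_eq inner_prod_def)
    also have "(\<Sum>i\<in>Basis. (c (i, 0) * (fst p \<bullet> i)) *\<^sub>R (i, 0::'b)) =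
        (1/2) *\<^sub>R (\<Sum>i\<in>Basis. ((fst p \<bullet> i) *\<^sub>R i, 0))"
      unfolding scaleR_sum_right by (intro sum.cong) (auto simp: c_def)
    also have "\<dots> = ((1/2) *\<^sub>R fst p, 0)"
      by (simp add: sum_prod euclidean_representation)
    also have "(\<Sum>i\<in>Basis. (c (0, i) * (snd p \<bullet> i)) *\<^sub>R (0::'a, i)) = (0, snd p)"
      by (simp add: c_def sum_prod euclidean_representation)
    finally show ?thesis by (simp add: \<tau>_def scaleR_add_right)
  qed
  have "lborel = density (distr lborel borel \<tau>) (\<lambda>_. (\<Prod>j\<in>Basis. \<bar>c j\<bar>))"
    unfolding \<tau>_def by (rule lborel_affine_euclidean) (simp add: c_def)
  then have "AE z in density (distr lborel borel \<tau>) (\<lambda>_. (\<Prod>j\<in>Basis. \<bar>c j\<bar>)). P z"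
    using assms by (simp only:)
  moreover have "0 < (\<Prod>j\<in>Basis. \<bar>c j\<bar>)" by (intro prod_pos) (auto simp: c_def)
  ultimately have "AE z in distr lborel borel \<tau>. P z"
    by (simp add: AE_density)
  moreover have "\<tau> \<in> lborel \<rightarrow>\<^sub>M borel"
    unfolding \<tau> measurable_lborel2
    by (intro borel_measurable_continuous_onI continuous_intros)
  ultimately have "AE p in lborel. P (\<tau> p)" by (rule AE_distrD[rotated])
  then show ?thesis by (simp add: \<tau>)
qed

text \<open>The symbols and test functions are merely Borel measurable, but they are only ever composed with
  continuous maps.\<close>

lemma borel_measurable_compose_continuous:
  fixes f :: "'b::topological_space \<Rightarrow> 'c::topological_space" and g :: "'a::topological_space \<Rightarrow> 'b"
  assumes "f \<in> borel_measurable borel" "continuous_on UNIV g"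
  shows "(\<lambda>x. f (g x)) \<in> borel_measurable borel"
  using borel_measurable_continuous_onI[OF assms(2)] assms(1) by (rule measurable_compose)

lemma measurable_borel_pair_lborel:
  "measurable (borel \<Otimes>\<^sub>M lborel) M =
     measurable (borel :: ('a::second_countable_topology \<times> 'b::euclidean_space) measure) M"
  by (rule measurable_cong_sets) (simp_all add: borel_prod[symmetric] cong: sets_pair_measure_cong)

lemma AE_lborel_fst:
  assumes "AE x in (lborel :: 'a::euclidean_space measure). P x"
    and P: "{x. P x} \<in> sets borel"
  shows "AE p in (lborel :: ('a \<times> 'b::euclidean_space) measure). P (fst p)"
proof -
  have "AE p in (lborel :: 'a measure) \<Otimes>\<^sub>M (lborel :: 'b measure). P (fst p)"
  proof (rule lborel_pair.AE_pair_measure)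
    have "fst -` {x. P x} \<inter> space borel \<in> sets (borel :: ('a \<times> 'b) measure)"
      by (intro measurable_sets[OF _ P] borel_measurable_continuous_onI continuous_intros)
    then show "{p \<in> space (lborel \<Otimes>\<^sub>M lborel). P (fst p)} \<in> sets ((lborel :: 'a measure) \<Otimes>\<^sub>M (lborel :: 'b measure))"
      unfolding lborel_prod by (simp add: vimage_def)
  qed (use assms(1) in \<open>auto elim!: eventually_mono\<close>)
  then show ?thesis by (simp only: lborel_prod)
qed

definition weyl_kernel ::
    "((real^'d^'n) \<times> (real^'d^'n) \<Rightarrow> complex) \<Rightarrow> (real^'d^'n \<Rightarrow> complex)
      \<Rightarrow> real^'d^'n \<Rightarrow> (real^'d^'n) \<times> (real^'d^'n) \<Rightarrow> complex" where
  "weyl_kernel \<sigma> F x p =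
     \<sigma> ((1/2) *\<^sub>R (x + fst p), snd p) * F (fst p) * exp (2 * of_real pi * \<i> * of_real ((x - fst p) \<bullet> snd p))"

lemma weyl_op_eq: "weyl_op \<sigma> F x = (LINT p|lborel. weyl_kernel \<sigma> F x p)"
  by (simp add: weyl_op_def weyl_kernel_def case_prod_unfold)

lemma weyl_kernel_measurable:
  fixes \<sigma> :: "(real^'d::finite^'n::finite) \<times> (real^'d^'n) \<Rightarrow> complex"
  assumes [measurable]: "\<sigma> \<in> borel_measurable borel" "F \<in> borel_measurable borel"
  shows "(\<lambda>q. weyl_kernel \<sigma> F (fst q) (snd q)) \<in> borel_measurable borel"
  unfolding weyl_kernel_def
  by (intro borel_measurable_times borel_measurable_compose_continuous[OF assms(1)]
      borel_measurable_compose_continuous[OF assms(2)] borel_measurable_continuous_onI continuous_intros)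

text \<open>The basic estimate. The symbol is bounded through its decay in \<open>\<omega>\<close>, which makes the bound uniform
  in \<open>x\<close>; the decay in \<open>y\<close> comes from \<open>F\<close>.\<close>

lemma weyl_kernel_bound:
  fixes \<sigma> :: "(real^'d::finite^'n::finite) \<times> (real^'d^'n) \<Rightarrow> complex"
  assumes "decays 1 c \<sigma>" and F: "decays 1 a F"
    and [measurable]: "F \<in> borel_measurable borel"
  shows "AE p in lborel. norm (weyl_kernel \<sigma> F x p) \<le> c * a * exp (- norm p)"
proof -
  have "AE p in lborel. norm (\<sigma> ((1/2) *\<^sub>R (x + fst p), snd p)) \<le>
      c * exp (- (1 * norm ((1/2) *\<^sub>R (x + fst p), snd p)))"
    by (rule AE_lborel_midpoint) (use assms(1) in \<open>simp add: decays_def\<close>)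
  moreover have "AE p in (lborel :: ((real^'d^'n) \<times> (real^'d^'n)) measure).
      norm (F (fst p)) \<le> a * exp (- (1 * norm (fst p)))"
    by (rule AE_lborel_fst) (use F in \<open>auto simp: decays_def\<close>)
  ultimately show ?thesis
  proof eventually_elim
    case (elim p)
    have c: "0 \<le> c" and a: "0 \<le> a" using assms decays_nonneg by blast+
    have "norm (weyl_kernel \<sigma> F x p) = norm (\<sigma> ((1/2) *\<^sub>R (x + fst p), snd p)) * norm (F (fst p))"
      by (simp add: weyl_kernel_def norm_mult norm_exp_2pi_i)
    also have "\<dots> \<le> (c * exp (- norm (snd p))) * (a * exp (- norm (fst p)))"
    proof (rule mult_mono)
      have "norm (\<sigma> ((1/2) *\<^sub>R (x + fst p), snd p)) \<le> c * exp (- norm ((1/2) *\<^sub>R (x + fst p), snd p))"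
        using elim by simp
      also have "\<dots> \<le> c * exp (- norm (snd p))"
        using c norm_snd_le[of "snd p" "(1/2) *\<^sub>R (x + fst p)"] by (intro mult_left_mono) auto
      finally show "norm (\<sigma> ((1/2) *\<^sub>R (x + fst p), snd p)) \<le> c * exp (- norm (snd p))" .
    qed (use elim c in auto)
    also have "\<dots> = c * a * exp (- (norm (fst p) + norm (snd p)))"
      by (simp add: exp_add exp_diff exp_minus field_simps)
    also have "\<dots> \<le> c * a * exp (- norm p)"
      using a c norm_Pair_le[of "fst p" "snd p"] by (intro mult_left_mono) auto
    finally show ?case .
  qed
qed

lemma weyl_kernel_integral:
  fixes \<sigma> :: "(real^'d::finite^'n::finite) \<times> (real^'d^'n) \<Rightarrow> complex"
  assumes [measurable]: "\<sigma> \<in> borel_measurable borel" "F \<in> borel_measurable borel"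
    and dec: "decays 1 c \<sigma>" "decays 1 a F"
  defines "I \<equiv> (LINT p|lborel. exp (- norm (p :: (real^'d^'n) \<times> (real^'d^'n))))"
  shows "integrable lborel (weyl_kernel \<sigma> F x)"
    and "(LINT p|lborel. norm (weyl_kernel \<sigma> F x p)) \<le> c * I * a"
    and "norm (weyl_op \<sigma> F x) \<le> c * I * a"
proof -
  note bound = weyl_kernel_bound[OF dec assms(2), of x]
  have c: "0 \<le> c" and a: "0 \<le> a" using dec decays_nonneg by blast+
  have dom: "integrable lborel (\<lambda>p :: (real^'d^'n) \<times> (real^'d^'n). c * a * exp (- norm p))"
    by (intro integrable_mult_right integrable_exp_minus_norm)
  have [measurable]: "weyl_kernel \<sigma> F x \<in> borel_measurable borel"
    using borel_measurable_compose_continuous[OF weyl_kernel_measurable[OF assms(1,2)], of "\<lambda>p. (x, p)"]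
    by (simp add: continuous_intros)
  show int: "integrable lborel (weyl_kernel \<sigma> F x)"
    by (rule Bochner_Integration.integrable_bound[OF dom]) (use bound a c in \<open>auto simp: abs_mult\<close>)
  have "(LINT p|lborel. norm (weyl_kernel \<sigma> F x p)) \<le>
      (LINT p|lborel. c * a * exp (- norm (p :: (real^'d^'n) \<times> (real^'d^'n))))"
    by (intro integral_mono_AE dom integrable_norm int bound)
  also have "\<dots> = c * I * a" by (simp add: I_def)
  finally show le: "(LINT p|lborel. norm (weyl_kernel \<sigma> F x p)) \<le> c * I * a" .
  show "norm (weyl_op \<sigma> F x) \<le> c * I * a"
    unfolding weyl_op_eq using integral_norm_bound[of lborel "weyl_kernel \<sigma> F x"] le by linarith
qed

lemma weyl_op_measurable[measurable]:
  fixes \<sigma> :: "(real^'d::finite^'n::finite) \<times> (real^'d^'n) \<Rightarrow> complex"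
  assumes [measurable]: "\<sigma> \<in> borel_measurable borel" "F \<in> borel_measurable borel"
  shows "weyl_op \<sigma> F \<in> borel_measurable borel"
proof -
  have [measurable]: "(\<lambda>(x, p). weyl_kernel \<sigma> F x p) \<in> borel_measurable (borel \<Otimes>\<^sub>M lborel)"
    using weyl_kernel_measurable[OF assms] by (simp add: case_prod_unfold measurable_borel_pair_lborel)
  show ?thesis unfolding weyl_op_eq[abs_def] by measurable
qed

lemma weyl_op_lincomb:
  fixes \<sigma> :: "(real^'d::finite^'n::finite) \<times> (real^'d^'n) \<Rightarrow> complex"
  assumes "\<sigma> \<in> GS" "F \<in> GS" "G \<in> GS"
  shows "weyl_op \<sigma> (\<lambda>y. a * F y + b * G y) x = a * weyl_op \<sigma> F x + b * weyl_op \<sigma> G x"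
proof -
  have "integrable lborel (weyl_kernel \<sigma> H x)" if "H \<in> GS" for H
    using assms(1) that by (metis GS_iff weyl_kernel_integral(1) zero_less_one)
  moreover have "weyl_kernel \<sigma> (\<lambda>y. a * F y + b * G y) x p =
      a * weyl_kernel \<sigma> F x p + b * weyl_kernel \<sigma> G x p" for p
    by (simp add: weyl_kernel_def algebra_simps)
  ultimately show ?thesis
    using assms(2,3) by (simp add: weyl_op_eq)
qed

section \<open>Duality with the Wigner transform\<close>

lemma nn_integral_lborel_Pair:
  fixes f :: "'a::euclidean_space \<times> 'b::euclidean_space \<Rightarrow> ennreal"
  assumes "f \<in> borel_measurable borel"
  shows "(\<integral>\<^sup>+p. f p \<partial>lborel) = (\<integral>\<^sup>+x. \<integral>\<^sup>+y. f (x, y) \<partial>lborel \<partial>lborel)"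
proof -
  have "f \<in> borel_measurable (lborel \<Otimes>\<^sub>M lborel)"
    using assms by (simp add: lborel_prod)
  from lborel.nn_integral_fst[OF this] show ?thesis by (simp only: lborel_prod)
qed

lemma integral_lborel_Pair:
  fixes f :: "'a::euclidean_space \<times> 'b::euclidean_space \<Rightarrow> complex"
  assumes "integrable lborel f"
  shows "(LINT x|lborel. LINT y|lborel. f (x, y)) = (LINT p|lborel. f p)"
  using lborel_pair.integral_fst'[of f] assms by (simp only: lborel_prod)

lemma nn_integral_lborel_commute:
  fixes f :: "'a::euclidean_space \<Rightarrow> 'b::euclidean_space \<Rightarrow> ennreal"
  assumes "case_prod f \<in> borel_measurable borel"
  shows "(\<integral>\<^sup>+x. \<integral>\<^sup>+y. f x y \<partial>lborel \<partial>lborel) = (\<integral>\<^sup>+y. \<integral>\<^sup>+x. f x y \<partial>lborel \<partial>lborel)"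
  by (rule lborel_pair.Fubini'[symmetric]) (use assms in \<open>simp add: lborel_prod\<close>)

lemma nn_integral_lborel_translate:
  fixes f :: "'a::euclidean_space \<Rightarrow> ennreal"
  assumes [measurable]: "f \<in> borel_measurable borel"
  shows "(\<integral>\<^sup>+x. f (c + x) \<partial>lborel) = (\<integral>\<^sup>+x. f x \<partial>lborel)"
  by (subst (2) lborel_distr_plus[of c, symmetric]) (simp add: nn_integral_distr)

lemma nn_integral_lborel_reflect:
  fixes f :: "'a::euclidean_space \<Rightarrow> ennreal"
  assumes [measurable]: "f \<in> borel_measurable borel"
  shows "(\<integral>\<^sup>+x. f (c - x) \<partial>lborel) = (\<integral>\<^sup>+x. f x \<partial>lborel)"
proof -
  have "distr lborel borel (\<lambda>x. c - x) = (lborel :: 'a measure)"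
    using lborel_affine[of "-1" c] by (simp add: density_1)
  then show ?thesis
    using nn_integral_distr[of "\<lambda>x. c - x" lborel borel f] by simp
qed

text \<open>The inverse of the passage from \<open>(x, y)\<close> to the midpoint \<open>z\<close> and the difference \<open>t\<close>. The pairs are nested
  so that the source is \<open>(z, \<omega>)\<close> followed by the integration variable \<open>t\<close> of the Wigner transform,
  and the target is \<open>x\<close> followed by the integration variables \<open>(y, \<omega>)\<close> of the Weyl operator.\<close>

definition wigner_coords :: "('a::euclidean_space \<times> 'b) \<times> 'a \<Rightarrow> 'a \<times> ('a \<times> 'b)" where
  "wigner_coords = (\<lambda>((z, \<omega>), t). (z + (1/2) *\<^sub>R t, (z - (1/2) *\<^sub>R t, \<omega>)))"

lemma wigner_coords_measurable[measurable]:
  "(wigner_coords :: ('a::euclidean_space \<times> 'b::euclidean_space) \<times> 'a \<Rightarrow> _) \<in> borel \<rightarrow>\<^sub>M borel"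
  unfolding wigner_coords_def case_prod_unfold
  by (intro borel_measurable_continuous_onI continuous_intros)

text \<open>By Tonelli's theorem the substitution can be done one variable at a time: for fixed \<open>t\<close> the
  translation \<open>x = z + t/2\<close>, then for fixed \<open>x\<close> the reflection \<open>y = x - t\<close>. Neither scales, so no
  Jacobian determinant has to be computed. The variable \<open>\<omega>\<close> is integrated out beforehand into \<open>v\<close>.\<close>

lemma nn_integral_wigner_coords:
  fixes u :: "'a::euclidean_space \<times> ('a \<times> 'b::euclidean_space) \<Rightarrow> ennreal"
  assumes [measurable]: "u \<in> borel_measurable borel"
  shows "(\<integral>\<^sup>+p. u (wigner_coords p) \<partial>lborel) = (\<integral>\<^sup>+q. u q \<partial>lborel)"
proof -
  define v where "v x y = (\<integral>\<^sup>+\<omega>. u (x, (y, \<omega>)) \<partial>lborel)" for x y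
  have "(\<lambda>(q, \<omega>). u (fst q, (snd q, \<omega>))) \<in> borel_measurable (borel \<Otimes>\<^sub>M lborel)"
    unfolding measurable_borel_pair_lborel case_prod_unfold
    by (intro borel_measurable_compose_continuous[OF assms] continuous_intros)
  then have v_meas: "(\<lambda>q. v (fst q) (snd q)) \<in> borel_measurable borel"
    unfolding v_def by (rule lborel.borel_measurable_nn_integral)
  have v_comp: "(\<lambda>p. v (f p) (g p)) \<in> borel_measurable borel"
    if "continuous_on UNIV f" "continuous_on UNIV g" for f g :: "'c::topological_space \<Rightarrow> 'a"
    using borel_measurable_compose_continuous[OF v_meas continuous_on_Pair[OF that]] by simp
  define w where "w z \<omega> = (\<integral>\<^sup>+t. u (z + (1/2) *\<^sub>R t, (z - (1/2) *\<^sub>R t, \<omega>)) \<partial>lborel)" for z \<omega>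
  have "(\<lambda>(q, t). u (fst q + (1/2) *\<^sub>R t, (fst q - (1/2) *\<^sub>R t, snd q))) \<in> borel_measurable (borel \<Otimes>\<^sub>M lborel)"
    unfolding measurable_borel_pair_lborel case_prod_unfold
    by (intro borel_measurable_compose_continuous[OF assms] continuous_intros)
  then have w_meas: "(\<lambda>q. w (fst q) (snd q)) \<in> borel_measurable borel"
    unfolding w_def by (rule lborel.borel_measurable_nn_integral)
  have "(\<integral>\<^sup>+p. u (wigner_coords p) \<partial>lborel) = (\<integral>\<^sup>+q. w (fst q) (snd q) \<partial>lborel)"
    using measurable_compose[OF wigner_coords_measurable assms]
    by (subst nn_integral_lborel_Pair) (simp_all add: wigner_coords_def w_def case_prod_unfold)
  also have "\<dots> = (\<integral>\<^sup>+z. \<integral>\<^sup>+\<omega>. \<integral>\<^sup>+t. u (z + (1/2) *\<^sub>R t, (z - (1/2) *\<^sub>R t, \<omega>)) \<partial>lborel \<partial>lborel \<partial>lborel)"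
    using w_meas by (subst nn_integral_lborel_Pair) (simp_all add: w_def)
  also have "\<dots> = (\<integral>\<^sup>+z. \<integral>\<^sup>+t. v (z + (1/2) *\<^sub>R t) (z - (1/2) *\<^sub>R t) \<partial>lborel \<partial>lborel)"
    unfolding v_def case_prod_unfold
    by (intro nn_integral_cong nn_integral_lborel_commute, unfold case_prod_unfold)
      (intro borel_measurable_compose_continuous[OF assms] continuous_intros)
  also have "\<dots> = (\<integral>\<^sup>+t. \<integral>\<^sup>+z. v (z + (1/2) *\<^sub>R t) (z - (1/2) *\<^sub>R t) \<partial>lborel \<partial>lborel)"
    by (rule nn_integral_lborel_commute, unfold case_prod_unfold) (intro v_comp continuous_intros)
  also have "\<dots> = (\<integral>\<^sup>+t. \<integral>\<^sup>+x. v x (x - t) \<partial>lborel \<partial>lborel)"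
  proof (rule nn_integral_cong)
    fix t :: 'a
    have "z + (1/2) *\<^sub>R t - t = z - (1/2) *\<^sub>R t" for z :: 'a
      by (simp add: algebra_simps flip: scaleR_2)
    then have "(\<integral>\<^sup>+z. v (z + (1/2) *\<^sub>R t) (z - (1/2) *\<^sub>R t) \<partial>lborel) =
        (\<integral>\<^sup>+z. v ((1/2) *\<^sub>R t + z) ((1/2) *\<^sub>R t + z - t) \<partial>lborel)"
      by (simp only: add.commute)
    also have "\<dots> = (\<integral>\<^sup>+x. v x (x - t) \<partial>lborel)"
      by (rule nn_integral_lborel_translate) (intro v_comp continuous_intros)
    finally show "(\<integral>\<^sup>+z. v (z + (1/2) *\<^sub>R t) (z - (1/2) *\<^sub>R t) \<partial>lborel) = (\<integral>\<^sup>+x. v x (x - t) \<partial>lborel)" .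
  qed
  also have "\<dots> = (\<integral>\<^sup>+x. \<integral>\<^sup>+t. v x (x - t) \<partial>lborel \<partial>lborel)"
    by (rule nn_integral_lborel_commute, unfold case_prod_unfold) (intro v_comp continuous_intros)
  also have "\<dots> = (\<integral>\<^sup>+x. \<integral>\<^sup>+y. v x y \<partial>lborel \<partial>lborel)"
    by (intro nn_integral_cong nn_integral_lborel_reflect v_comp continuous_intros)
  also have "\<dots> = (\<integral>\<^sup>+x. \<integral>\<^sup>+q. u (x, q) \<partial>lborel \<partial>lborel)"
    unfolding v_def
    by (intro nn_integral_cong nn_integral_lborel_Pair[symmetric]
        borel_measurable_compose_continuous[OF assms] continuous_intros)
  also have "\<dots> = (\<integral>\<^sup>+q. u q \<partial>lborel)"
    by (rule nn_integral_lborel_Pair[symmetric]) fact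
  finally show ?thesis .
qed

lemma distr_wigner_coords:
  "distr lborel borel wigner_coords =
     (lborel :: ('a::euclidean_space \<times> ('a \<times> 'b::euclidean_space)) measure)"
proof (rule measure_eqI)
  fix A :: "('a \<times> ('a \<times> 'b)) set"
  assume "A \<in> sets (distr lborel borel wigner_coords)"
  then have [measurable]: "A \<in> sets borel" by simp
  have "emeasure (distr lborel borel wigner_coords) A =
      (\<integral>\<^sup>+q. indicator A q \<partial>distr lborel borel wigner_coords)" by simp
  also have "\<dots> = (\<integral>\<^sup>+p. indicator A (wigner_coords p) \<partial>lborel)"
    by (rule nn_integral_distr) auto
  also have "\<dots> = (\<integral>\<^sup>+q. indicator A q \<partial>lborel)"
    by (rule nn_integral_wigner_coords) simp
  finally show "emeasure (distr lborel borel wigner_coords) A = emeasure lborel A" by simp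
qed simp

text \<open>Absolute convergence of the integral over all of \<open>(x, y, \<omega>)\<close>, the licence for Fubini's theorem below:
  the inner integral of the absolute value is bounded in \<open>x\<close>, and \<open>\<phi>\<close> is integrable.\<close>

lemma integrable_weyl_pairing:
  fixes \<sigma> :: "(real^'d::finite^'n::finite) \<times> (real^'d^'n) \<Rightarrow> complex"
  assumes "\<sigma> \<in> GS" "F \<in> GS" "\<phi> \<in> GS"
  shows "integrable lborel (\<lambda>q. weyl_kernel \<sigma> F (fst q) (snd q) * \<phi> (fst q))"
proof -
  obtain c a where dec: "decays 1 c \<sigma>" "decays 1 a F" using assms by (metis GS_iff zero_less_one)
  have meas[measurable]: "\<sigma> \<in> borel_measurable borel" "F \<in> borel_measurable borel" "\<phi> \<in> borel_measurable borel"
    using assms by (simp_all add: GS_iff)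
  note ker = weyl_kernel_integral[OF meas(1,2) dec]
  let ?I = "LINT p|lborel. exp (- norm (p :: (real^'d^'n) \<times> (real^'d^'n)))"
  have [measurable]: "(\<lambda>(x, p). weyl_kernel \<sigma> F x p) \<in> borel_measurable (borel \<Otimes>\<^sub>M lborel)"
    using weyl_kernel_measurable[OF meas(1,2)] by (simp add: case_prod_unfold measurable_borel_pair_lborel)
  have "integrable (lborel \<Otimes>\<^sub>M lborel) (\<lambda>q. weyl_kernel \<sigma> F (fst q) (snd q) * \<phi> (fst q))"
  proof (rule lborel_pair.Fubini_integrable)
    show "(\<lambda>q. weyl_kernel \<sigma> F (fst q) (snd q) * \<phi> (fst q)) \<in> borel_measurable (lborel \<Otimes>\<^sub>M lborel)"
      unfolding lborel_prod
      using borel_measurable_times[OF weyl_kernel_measurable[OF meas(1,2)]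
          borel_measurable_compose_continuous[OF meas(3), of fst]] by (simp add: continuous_intros)
    show "AE x in lborel. integrable lborel (\<lambda>p. weyl_kernel \<sigma> F (fst (x, p)) (snd (x, p)) * \<phi> (fst (x, p)))"
      using ker(1) by simp
    have "integrable lborel (\<lambda>x. (LINT p|lborel. norm (weyl_kernel \<sigma> F x p)) * norm (\<phi> x))"
    proof (rule Bochner_Integration.integrable_bound)
      show "integrable lborel (\<lambda>x. c * ?I * a * norm (\<phi> x))"
        by (intro integrable_mult_right integrable_norm GS_integrable assms)
      show "AE x in lborel. norm ((LINT p|lborel. norm (weyl_kernel \<sigma> F x p)) * norm (\<phi> x))
          \<le> norm (c * ?I * a * norm (\<phi> x))"
      proof (rule AE_I2)
        fix x
        have "0 \<le> (LINT p|lborel. norm (weyl_kernel \<sigma> F x p))" by simp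
        with ker(2)[of x] have "\<bar>LINT p|lborel. norm (weyl_kernel \<sigma> F x p)\<bar> \<le> \<bar>c * ?I * a\<bar>" by linarith
        then show "norm ((LINT p|lborel. norm (weyl_kernel \<sigma> F x p)) * norm (\<phi> x))
          \<le> norm (c * ?I * a * norm (\<phi> x))"
          unfolding real_norm_def abs_mult by (intro mult_right_mono) (auto simp: abs_mult)
      qed
    qed measurable
    then show "integrable lborel (\<lambda>x. LINT p|lborel. norm (weyl_kernel \<sigma> F (fst (x, p)) (snd (x, p)) * \<phi> (fst (x, p))))"
      by (simp add: norm_mult)
  qed
  then show ?thesis by (simp only: lborel_prod)
qed

lemma weyl_wigner_duality:
  fixes \<sigma> :: "(real^'d::finite^'n::finite) \<times> (real^'d^'n) \<Rightarrow> complex"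
  assumes "\<sigma> \<in> GS" "tensor f \<in> GS" "tensor g \<in> GS"
  shows "(LINT x|lborel. weyl_op \<sigma> (tensor f) x * cnj (tensor g x)) = L2_inner \<sigma> (wigner g f)"
proof -
  define \<Psi> where "\<Psi> q = weyl_kernel \<sigma> (tensor f) (fst q) (snd q) * cnj (tensor g (fst q))" for q
  have int: "integrable lborel \<Psi>"
    unfolding \<Psi>_def by (intro integrable_weyl_pairing GS_cnj assms)
  have int': "integrable lborel (\<lambda>p. \<Psi> (wigner_coords p))"
    using int integrable_distr[of wigner_coords lborel borel \<Psi>] by (simp add: distr_wigner_coords)
  have "(LINT x|lborel. weyl_op \<sigma> (tensor f) x * cnj (tensor g x)) =
      (LINT x|lborel. LINT p|lborel. \<Psi> (x, p))"
    by (simp add: \<Psi>_def weyl_op_eq)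
  also have "\<dots> = (LINT q|lborel. \<Psi> q)"
    by (rule integral_lborel_Pair[OF int])
  also have "\<dots> = (LINT p|lborel. \<Psi> (wigner_coords p))"
    using integral_distr[of wigner_coords lborel borel \<Psi>] int by (simp add: distr_wigner_coords)
  also have "\<dots> = (LINT z|lborel. LINT t|lborel. \<Psi> (wigner_coords (z, t)))"
    by (rule integral_lborel_Pair[OF int', symmetric])
  also have "\<dots> = (LINT z|lborel. \<sigma> z * cnj (wigner g f z))"
  proof (rule Bochner_Integration.integral_cong[OF refl])
    fix z :: "(real^'d^'n) \<times> (real^'d^'n)"
    obtain x \<omega> where z: "z = (x, \<omega>)" by fastforce
    have half: "x + (1/2) *\<^sub>R t + (x - (1/2) *\<^sub>R t) = 2 *\<^sub>R x" for t
      by (simp add: scaleR_2)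
    have diff: "x + (1/2) *\<^sub>R t - (x - (1/2) *\<^sub>R t) = t" for t
      by (simp add: scaleR_add_left[symmetric])
    have "\<Psi> (wigner_coords (z, t)) =
        \<sigma> z * cnj ((\<Prod>j\<in>UNIV. g j (x $ j + (1/2) *\<^sub>R t $ j) * cnj (f j (x $ j - (1/2) *\<^sub>R t $ j)))
          * exp (- 2 * of_real pi * \<i> * of_real (\<omega> \<bullet> t)))" for t
      unfolding \<Psi>_def weyl_kernel_def wigner_coords_def z
      by (simp add: half diff tensor_def prod.distrib exp_cnj inner_commute[of t])
    then show "(LINT t|lborel. \<Psi> (wigner_coords (z, t))) = \<sigma> z * cnj (wigner g f z)"
      by (simp add: wigner_def z del: complex_cnj_mult)
  qed
  finally show ?thesis by (simp add: L2_inner_def)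
qed

text \<open>The bilinear estimate behind the continuity of the extension; the constant depends on the symbol
  and the dimension only.\<close>

lemma weyl_pairing:
  fixes \<sigma> :: "(real^'d::finite^'n::finite) \<times> (real^'d^'n) \<Rightarrow> complex"
  assumes \<sigma>: "\<sigma> \<in> borel_measurable borel" "decays 1 c \<sigma>"
    and F: "F \<in> borel_measurable borel" "decays 1 a F"
    and \<phi>: "\<phi> \<in> borel_measurable borel" "decays 1 b \<phi>"
  defines "I \<equiv> (LINT p|lborel. exp (- norm (p :: (real^'d^'n) \<times> (real^'d^'n))))"
    and "J \<equiv> (LINT x|lborel. exp (- norm (x :: real^'d^'n)))"
  shows "integrable lborel (\<lambda>x. weyl_op \<sigma> F x * \<phi> x)"
    and "norm (LINT x|lborel. weyl_op \<sigma> F x * \<phi> x) \<le> c * I * J * a * b"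
proof -
  note meas[measurable] = \<sigma>(1) F(1) \<phi>(1)
  have nonneg: "0 \<le> c" "0 \<le> a" "0 \<le> b" "0 \<le> I"
    using \<sigma> F \<phi> decays_nonneg by (blast, blast, blast, simp add: I_def)
  have dom: "integrable lborel (\<lambda>x :: real^'d^'n. c * I * a * (b * exp (- norm x)))"
    by (intro integrable_mult_right integrable_exp_minus_norm)
  have bound: "AE x in lborel. norm (weyl_op \<sigma> F x * \<phi> x) \<le> c * I * a * (b * exp (- norm x))"
    using \<phi>(2) unfolding decays_def
  proof eventually_elim
    case (elim x)
    have "norm (weyl_op \<sigma> F x) \<le> c * I * a"
      unfolding I_def by (rule weyl_kernel_integral(3)[OF \<sigma>(1) F(1) \<sigma>(2) F(2)])
    then show ?case
      unfolding norm_mult using elim nonneg by (intro mult_mono) auto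
  qed
  show int: "integrable lborel (\<lambda>x. weyl_op \<sigma> F x * \<phi> x)"
    by (rule Bochner_Integration.integrable_bound[OF dom])
      (use bound nonneg in \<open>auto simp: abs_mult\<close>)
  have "norm (LINT x|lborel. weyl_op \<sigma> F x * \<phi> x) \<le> (LINT x|lborel. norm (weyl_op \<sigma> F x * \<phi> x))"
    by (rule integral_norm_bound)
  also have "\<dots> \<le> (LINT x|lborel. c * I * a * (b * exp (- norm (x :: real^'d^'n))))"
    by (intro integral_mono_AE dom integrable_norm int bound)
  also have "\<dots> = c * I * J * a * b" by (simp add: J_def)
  finally show "norm (LINT x|lborel. weyl_op \<sigma> F x * \<phi> x) \<le> c * I * J * a * b" .
qed

theorem lemma3p3:
  fixes \<sigma> :: "(real^'d::finite^'n::finite) \<times> (real^'d^'n) \<Rightarrow> complex"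
  assumes "\<sigma> \<in> GS"
  shows "\<exists>T :: (real^'d^'n \<Rightarrow> complex) \<Rightarrow> ((real^'d^'n \<Rightarrow> complex) \<Rightarrow> complex).
    continuous_map GS_topology GS_dual_topology T \<and>
    (\<forall>\<phi>\<in>GS. clinear_on GS (\<lambda>F. T F \<phi>)) \<and>
    (\<forall>f :: 'n \<Rightarrow> real^'d \<Rightarrow> complex. (\<forall>j. f j \<in> GS) \<longrightarrow>
       tensor f \<in> GS \<and> represented_by (T (tensor f)) (weyl_op \<sigma> (tensor f))) \<and>
    (\<forall>f g :: 'n \<Rightarrow> real^'d \<Rightarrow> complex. (\<forall>j. f j \<in> GS) \<and> (\<forall>j. g j \<in> GS) \<longrightarrow>
       bracket (T (tensor f)) (tensor g) = L2_inner \<sigma> (wigner g f))"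
proof -
  let ?I = "LINT p|lborel. exp (- norm (p :: (real^'d^'n) \<times> (real^'d^'n)))"
  let ?J = "LINT x|lborel. exp (- norm (x :: real^'d^'n))"
  define T where "T F = restrict (\<lambda>\<phi>. LINT x|lborel. weyl_op \<sigma> F x * \<phi> x) GS"
    for F :: "real^'d^'n \<Rightarrow> complex"
  have T: "T F \<phi> = (LINT x|lborel. weyl_op \<sigma> F x * \<phi> x)" if "\<phi> \<in> GS" for F \<phi>
    using that by (simp add: T_def)
  obtain c where \<sigma>: "\<sigma> \<in> borel_measurable borel" "decays 1 c \<sigma>"
    using assms by (metis GS_iff zero_less_one)
  have int: "integrable lborel (\<lambda>x. weyl_op \<sigma> F x * \<phi> x)" if F: "F \<in> GS" and \<phi>: "\<phi> \<in> GS" for F \<phi>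
  proof -
    obtain a b where "decays 1 a F" "decays 1 b \<phi>"
      using F \<phi> by (metis GS_iff zero_less_one)
    then show ?thesis
      using weyl_pairing(1)[OF \<sigma> GS_measurable[OF F] _ GS_measurable[OF \<phi>]] by blast
  qed
  have lin: "clinear_on GS (T F)" if "F \<in> GS" for F
    using int[OF that] by (simp add: clinear_on_def T GS_lincomb distrib_left mult.left_commute)
  have lin': "clinear_on GS (\<lambda>F. T F \<phi>)" if "\<phi> \<in> GS" for \<phi>
    using int[OF _ that] that
    by (simp add: clinear_on_def T weyl_op_lincomb[OF assms] distrib_right mult.assoc)
  have "continuous_map GS_topology GS_dual_topology T"
  proof (rule continuous_map_GS_into_dual[OF _ lin lin'])
    show "norm (T F \<phi>) \<le> c * ?I * ?J * a * b"
      if "F \<in> GS" "\<phi> \<in> GS" "decays 1 a F" "decays 1 b \<phi>" for F \<phi> a b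
      using weyl_pairing(2)[OF \<sigma> GS_measurable that(3) GS_measurable that(4)] that by (simp add: T)
    show "0 \<le> c * ?I * ?J" using decays_nonneg[OF \<sigma>(2)] by simp
    show "T F \<in> extensional GS" if "F \<in> GS" for F
      unfolding T_def by (rule restrict_extensional)
  qed
  moreover have "represented_by (T F) (weyl_op \<sigma> F)" if "F \<in> GS" for F
    unfolding represented_by_def using int[OF that] T by blast
  moreover have "bracket (T (tensor f)) (tensor g) = L2_inner \<sigma> (wigner g f)"
    if "tensor f \<in> GS" "tensor g \<in> GS" for f g :: "'n \<Rightarrow> real^'d \<Rightarrow> complex"
    unfolding bracket_def T[OF GS_cnj[OF that(2)]] by (rule weyl_wigner_duality[OF assms that])
  ultimately show ?thesis
    using lin' by (intro exI[of _ T] conjI ballI allI impI) (simp_all add: tensor_in_GS)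
qed

end
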